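(* A tree $T$ is perfect for the stripe-game with Minimizer responding (and Maximizer initiating) if and only if $T$ belongs to the family $\mathcal{F}$.
   Context: Graphs are finite, simple and undirected; a tree has at least one vertex. $P_3$ is the path on three vertices; copies of $P_3$ in a graph are subgraphs, not necessarily induced. The stripe-game on a graph $G$ is played by two players, Maximizer and Minimizer; throughout the game one of them is the initiator and the other is the responder. In each round, the initiator chooses a vertex $v$ of the current graph such that the current graph contains at least one copy of $P_3$ with $v$ as an end-vertex; the responder then chooses one copy of $P_3$ in the current graph with $v$ as an end-vertex; the three vertices of that copy are removed, and the next round is played on the subgraph induced by the remaining vertices. The game ends when the remaining graph contains no copy of $P_3$. Maximizer tries to maximize, and Minimizer tries to minimize, the number of copies of $P_3$ taken. The value of the game is the number of copies taken under optimal play by both players. A graph is perfect (for a given version of the game) if under optimal play all vertices are taken, i.e. the value of the game equals $|V(G)|/3$. $\mathcal{F}$ is the family of forests obtained as follows: start with the empty graph; repeatedly (any finite number of times) add a new disjoint copy of $P_3$ with a designated end-vertex $v$, and join $v$ by an edge to at most one vertex in each existing component of the forest built so far. *)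

theory Defs
  imports "Graph_Theory.Digraph_Component"
begin

text \<open>
  Finite simple undirected graphs are the symmetric loop-free digraphs of the locale
  \<^locale>\<open>pair_graph\<close>: an edge between \<open>u\<close> and \<open>v\<close> is the pair of arcs \<open>(u, v)\<close>, \<open>(v, u)\<close>.

  The constant \<^const>\<open>tree\<close> cannot be used for such graphs: its notion of cycle
  includes walking along an edge and back. A cycle of the undirected graph is a
  \<^const>\<open>pre_digraph.cycle\<close> of length at least 3. Nonemptiness of a tree is part of
  \<^const>\<open>connected\<close>.
\<close>

definition undirected_tree :: "'a pair_pre_digraph \<Rightarrow> bool" where
  "undirected_tree G \<longleftrightarrow>
     pair_graph G \<and> connected (with_proj G) \<and>
     \<not> (\<exists>p. pre_digraph.cycle (with_proj G) p \<and> 3 \<le> length p)"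

definition delete_verts :: "'a pair_pre_digraph \<Rightarrow> 'a set \<Rightarrow> 'a pair_pre_digraph" where
  "delete_verts G S =
     \<lparr>pverts = pverts G - S, parcs = {(u, w) \<in> parcs G. u \<notin> S \<and> w \<notin> S}\<rparr>"

text \<open>
  \<open>P3_copies_from G v\<close> represents the copies of the three-vertex path in \<open>G\<close> having \<open>v\<close> as an
  end-vertex: the pair \<open>(x, y)\<close> stands for the path \<open>v, x, y\<close>. Adjacency of \<open>v\<close> and \<open>y\<close> is
  not excluded, since copies need not be induced.
\<close>

definition P3_copies_from :: "'a pair_pre_digraph \<Rightarrow> 'a \<Rightarrow> ('a \<times> 'a) set" where
  "P3_copies_from G v =
     {(x, y). {v, x, y} \<subseteq> pverts G \<and> distinct [v, x, y] \<and> (v, x) \<in> parcs G \<and> (x, y) \<in> parcs G}"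

definition initiator_moves :: "'a pair_pre_digraph \<Rightarrow> 'a set" where
  "initiator_moves G = {v \<in> pverts G. P3_copies_from G v \<noteq> {}}"

datatype player = Maximizer | Minimizer

fun opponent :: "player \<Rightarrow> player" where
  "opponent Maximizer = Minimizer"
| "opponent Minimizer = Maximizer"

fun best :: "player \<Rightarrow> nat set \<Rightarrow> nat" where
  "best Maximizer A = Max A"
| "best Minimizer A = Min A"

text \<open>
  The value of the stripe-game on \<open>G\<close> with initiator \<open>P\<close>. The result 0 for infinite graphs is
  a dummy value; for finite graphs all sets passed to \<^const>\<open>best\<close> are finite and nonempty.
\<close>

function stripe_value :: "player \<Rightarrow> 'a pair_pre_digraph \<Rightarrow> nat" where
  "stripe_value P G =
     (if infinite (pverts G) \<or> initiator_moves G = {} then 0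
      else 1 + best P ((\<lambda>v. best (opponent P)
             ((\<lambda>(x, y). stripe_value P (delete_verts G {v, x, y})) ` P3_copies_from G v))
             ` initiator_moves G))"
  by pat_completeness auto
termination
  by (relation "measure (\<lambda>(P, G). card (pverts G))")
     (auto simp: delete_verts_def P3_copies_from_def intro!: psubset_card_mono)

declare stripe_value.simps [simp del]

definition stripe_perfect :: "player \<Rightarrow> 'a pair_pre_digraph \<Rightarrow> bool" where
  "stripe_perfect P G \<longleftrightarrow> real (stripe_value P G) = real (card (pverts G)) / 3"

text \<open>
  In the inductive step, \<open>v, x, y\<close> is the new path with designated end-vertex \<open>v\<close>, and \<open>S\<close> is
  the set of old vertices to which \<open>v\<close> is joined. As the graphs are symmetric, the members of
  \<^const>\<open>pre_digraph.sccs_verts\<close> are the vertex sets of the connected components.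
\<close>

inductive_set stripe_family :: "'a pair_pre_digraph set" where
  empty: "\<lparr>pverts = {}, parcs = {}\<rparr> \<in> stripe_family"
| add_P3: "\<lbrakk>F \<in> stripe_family; distinct [v, x, y]; {v, x, y} \<inter> pverts F = {}; S \<subseteq> pverts F;
     \<forall>C \<in> pre_digraph.sccs_verts (with_proj F). card (S \<inter> C) \<le> 1\<rbrakk>
   \<Longrightarrow> \<lparr>pverts = pverts F \<union> {v, x, y},
        parcs = parcs F \<union> {(v, x), (x, v), (x, y), (y, x)} \<union> {v} \<times> S \<union> S \<times> {v}\<rparr>
      \<in> stripe_family"

end

theory Submission
  imports Defs
begin

text \<open>
  The proof runs through forests, so that it can peel off one path at a time.

  A member of the family is perfect: in the path \<open>v, x, y\<close> that was added last, the vertex \<open>y\<close> is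
  a leaf and \<open>x\<close> has no neighbours besides \<open>v\<close> and \<open>y\<close>. If Maximizer names \<open>y\<close>, then Minimizer has
  to take exactly this path, and the play goes on in the previous member of the family.

  Conversely, let \<open>v\<close> be a winning first move of Maximizer in a perfect forest. By induction every
  answer of Minimizer leaves a member of the family, and in such a member every connected component
  has a number of vertices divisible by 3 (\<open>three_dvd_card_closed\<close>). This divisibility leaves
  Minimizer no choice. If \<open>v\<close> had two neighbours \<open>x\<close> and \<open>z\<close>, then the branch at \<open>z\<close> of the forest
  without \<open>v\<close> survives an answer through \<open>x\<close> unchanged, but loses two vertices by an answer
  through \<open>z\<close>; both numbers cannot be divisible by 3. So \<open>v\<close> is a leaf. If its neighbour \<open>x\<close> had
  two further neighbours \<open>y\<close> and \<open>z\<close>, then the branch at \<open>z\<close> of the forest without \<open>x\<close> is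
  unchanged by the answer \<open>(x, y)\<close>, but loses one vertex by the answer \<open>(x, z)\<close>. So the path
  \<open>v, x, y\<close> is attached to the rest at \<open>y\<close> only, and by acyclicity \<open>y\<close> has at most one neighbour in
  each component of the rest: the forest arises from the rest by one step of the construction,
  with \<open>y\<close> as the designated end-vertex.
\<close>

section \<open>Perfection in terms of moves\<close>

lemma delete_verts_simps [simp]:
  "pverts (delete_verts G S) = pverts G - S"
  "parcs (delete_verts G S) = {(u, w) \<in> parcs G. u \<notin> S \<and> w \<notin> S}"
  by (simp_all add: delete_verts_def)

lemma P3_copies_fromD:
  assumes "(x, y) \<in> P3_copies_from G v"
  shows "v \<in> pverts G" "x \<in> pverts G" "y \<in> pverts G" "v \<noteq> x" "v \<noteq> y" "x \<noteq> y"
    "(v, x) \<in> parcs G" "(x, y) \<in> parcs G"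
  using assms by (auto simp: P3_copies_from_def)

lemma finite_P3_copies_from: "finite (pverts G) \<Longrightarrow> finite (P3_copies_from G v)"
  by (rule finite_subset[of _ "pverts G \<times> pverts G"]) (auto simp: P3_copies_from_def)

lemma card_delete_P3:
  assumes "(x, y) \<in> P3_copies_from G v" "finite (pverts G)"
  shows "card (pverts G) = card (pverts (delete_verts G {v, x, y})) + 3"
proof -
  note xy = P3_copies_fromD[OF assms(1)]
  have "card {v, x, y} = 3" using xy by simp
  moreover have "card (pverts G - {v, x, y}) + card {v, x, y} = card (pverts G)"
    using xy assms(2) by (metis add.commute card_Diff_subset card_mono finite_subset
        insert_subset empty_subsetI le_add_diff_inverse)
  ultimately show ?thesis by simp
qed

lemma stripe_value_Maximizer:
  assumes "finite (pverts G)" "initiator_moves G \<noteq> {}"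
  shows "stripe_value Maximizer G = 1 + Max ((\<lambda>v. Min ((\<lambda>(x, y).
    stripe_value Maximizer (delete_verts G {v, x, y})) ` P3_copies_from G v)) ` initiator_moves G)"
  using assms by (subst stripe_value.simps) simp

lemma stripe_value_Maximizer_le:
  assumes "finite (pverts G)"
  shows "3 * stripe_value Maximizer G \<le> card (pverts G)"
  using assms
proof (induction "card (pverts G)" arbitrary: G rule: less_induct)
  case less
  show ?case
  proof (cases "initiator_moves G = {}")
    case True
    then show ?thesis by (subst stripe_value.simps) simp
  next
    case False
    let ?m = "\<lambda>v. Min ((\<lambda>(x, y).
      stripe_value Maximizer (delete_verts G {v, x, y})) ` P3_copies_from G v)"
    have "Max (?m ` initiator_moves G) \<in> ?m ` initiator_moves G"
      using False less.prems by (intro Max_in) (auto simp: initiator_moves_def)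
    then obtain v where v: "v \<in> initiator_moves G" "Max (?m ` initiator_moves G) = ?m v" by blast
    then obtain x y where xy: "(x, y) \<in> P3_copies_from G v" by (auto simp: initiator_moves_def)
    have "?m v \<le> stripe_value Maximizer (delete_verts G {v, x, y})"
      using xy less.prems finite_P3_copies_from[OF less.prems] by (intro Min_le) (auto intro!: image_eqI)
    moreover have "3 * stripe_value Maximizer (delete_verts G {v, x, y})
        \<le> card (pverts (delete_verts G {v, x, y}))"
      using card_delete_P3[OF xy less.prems] less.prems by (intro less.hyps) simp_all
    ultimately show ?thesis
      using card_delete_P3[OF xy less.prems] stripe_value_Maximizer[OF less.prems False] v(2) by simp
  qed
qed

lemma stripe_perfect_iff: "stripe_perfect P G \<longleftrightarrow> 3 * stripe_value P G = card (pverts G)"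
  unfolding stripe_perfect_def by linarith

text \<open>
  Since no position is worth more than a third of its vertices, an optimal outcome leaves no
  slack anywhere: the maximum and the minimum in the value turn into quantifiers.
\<close>

lemma stripe_perfect_Maximizer_iff_move:
  assumes fin: "finite (pverts G)"
  shows "stripe_perfect Maximizer G \<longleftrightarrow> pverts G = {} \<or>
    (\<exists>v \<in> initiator_moves G. \<forall>(x, y) \<in> P3_copies_from G v.
       stripe_perfect Maximizer (delete_verts G {v, x, y}))"
proof (cases "initiator_moves G = {}")
  case True
  then show ?thesis
    using fin by (subst stripe_perfect_iff, subst stripe_value.simps) auto
next
  case False
  define f where "f v = (\<lambda>(x, y). stripe_value Maximizer (delete_verts G {v, x, y}))" for v
  define m where "m v = Min (f v ` P3_copies_from G v)" for v
  have val: "stripe_value Maximizer G = 1 + Max (m ` initiator_moves G)"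
    using stripe_value_Maximizer[OF fin False] by (simp add: m_def f_def)
  have finm: "finite (initiator_moves G)" using fin by (simp add: initiator_moves_def)
  have ne: "pverts G \<noteq> {}" using False by (auto simp: initiator_moves_def)
  have f_le: "3 * f v p + 3 \<le> card (pverts G)" if "p \<in> P3_copies_from G v" for v p
    using that card_delete_P3[of "fst p" "snd p" G v] fin
      stripe_value_Maximizer_le[of "delete_verts G {v, fst p, snd p}"]
    by (cases p) (simp add: f_def)
  have perf: "stripe_perfect Maximizer (delete_verts G {v, fst p, snd p})
      \<longleftrightarrow> 3 * f v p + 3 = card (pverts G)" if "p \<in> P3_copies_from G v" for v p
    using that card_delete_P3[of "fst p" "snd p" G v] fin
    by (cases p) (simp add: f_def stripe_perfect_iff)
  have m_iff: "3 * m v + 3 = card (pverts G)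
      \<longleftrightarrow> (\<forall>p \<in> P3_copies_from G v. 3 * f v p + 3 = card (pverts G))"
    and m_le: "3 * m v + 3 \<le> card (pverts G)" if v: "v \<in> initiator_moves G" for v
  proof -
    have nev: "P3_copies_from G v \<noteq> {}" using v by (simp add: initiator_moves_def)
    have finv: "finite (P3_copies_from G v)" using finite_P3_copies_from[OF fin] .
    have "m v \<in> f v ` P3_copies_from G v" unfolding m_def using finv nev by (intro Min_in) auto
    then obtain p where p: "p \<in> P3_copies_from G v" "m v = f v p" by auto
    have le: "m v \<le> f v q" if "q \<in> P3_copies_from G v" for q
      unfolding m_def using finv that by (intro Min_le) auto
    show "3 * m v + 3 \<le> card (pverts G)" using f_le[OF p(1)] p(2) by simp
    show "3 * m v + 3 = card (pverts G)
      \<longleftrightarrow> (\<forall>p \<in> P3_copies_from G v. 3 * f v p + 3 = card (pverts G))"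
    proof
      assume "3 * m v + 3 = card (pverts G)"
      then show "\<forall>q \<in> P3_copies_from G v. 3 * f v q + 3 = card (pverts G)"
        using le f_le by (fastforce intro: le_antisym)
    next
      assume "\<forall>q \<in> P3_copies_from G v. 3 * f v q + 3 = card (pverts G)"
      then show "3 * m v + 3 = card (pverts G)" using p by simp
    qed
  qed
  have "stripe_perfect Maximizer G \<longleftrightarrow> 3 * Max (m ` initiator_moves G) + 3 = card (pverts G)"
    by (simp add: stripe_perfect_iff val add.commute)
  also have "\<dots> \<longleftrightarrow> (\<exists>v \<in> initiator_moves G. 3 * m v + 3 = card (pverts G))"
  proof -
    have "Max (m ` initiator_moves G) \<in> m ` initiator_moves G"
      using finm False by (intro Max_in) auto
    then obtain v where v: "v \<in> initiator_moves G" "Max (m ` initiator_moves G) = m v" by auto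
    have le: "m w \<le> Max (m ` initiator_moves G)" if "w \<in> initiator_moves G" for w
      using finm that by (intro Max_ge) auto
    have "3 * m w + 3 \<le> 3 * m v + 3" "3 * m v + 3 \<le> card (pverts G)"
      if "w \<in> initiator_moves G" for w
      using le[OF that] m_le[OF v(1)] v(2) by simp_all
    then show ?thesis using v by (metis le_antisym)
  qed
  also have "\<dots> \<longleftrightarrow> (\<exists>v \<in> initiator_moves G. \<forall>(x, y) \<in> P3_copies_from G v.
       stripe_perfect Maximizer (delete_verts G {v, x, y}))"
  proof (intro bex_cong refl)
    fix v assume "v \<in> initiator_moves G"
    from m_iff[OF this] show "3 * m v + 3 = card (pverts G) \<longleftrightarrow>
        (\<forall>(x, y) \<in> P3_copies_from G v. stripe_perfect Maximizer (delete_verts G {v, x, y}))"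
      unfolding case_prod_beta using perf by blast
  qed
  finally show ?thesis using ne by simp
qed

section \<open>Members of the family\<close>

lemma stripe_family_wf:
  assumes "F \<in> stripe_family"
  shows "finite (pverts F) \<and> parcs F \<subseteq> pverts F \<times> pverts F"
  using assms
proof induction
  case (add_P3 F v x y S)
  show ?case using add_P3.IH add_P3.hyps(4) by (clarsimp, blast)
qed simp

lemma stripe_family_perfect:
  assumes "F \<in> stripe_family"
  shows "stripe_perfect Maximizer F"
  using assms
proof induction
  case empty
  show ?case by (subst stripe_perfect_Maximizer_iff_move) auto
next
  case (add_P3 F v x y S)
  let ?G = "\<lparr>pverts = pverts F \<union> {v, x, y},
        parcs = parcs F \<union> {(v, x), (x, v), (x, y), (y, x)} \<union> {v} \<times> S \<union> S \<times> {v}\<rparr>"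
  note wf = stripe_family_wf[OF add_P3.hyps(1)]
  have forced: "P3_copies_from ?G y = {(x, v)}"
    using add_P3.hyps wf by (auto simp: P3_copies_from_def)
  have "delete_verts ?G {y, x, v} = F"
    using add_P3.hyps wf by (intro pair_pre_digraph.equality) auto
  then show ?case
    using forced add_P3.IH wf
    by (subst stripe_perfect_Maximizer_iff_move) (auto simp: initiator_moves_def)
qed

text \<open>
  The closed sets are the unions of connected components. Speaking of closed sets instead of
  components makes the induction immediate, because a closed set contains the new path
  completely or not at all, and it restricts to a closed set of the old forest.
\<close>

lemma three_dvd_card_closed:
  assumes "F \<in> stripe_family" "A \<subseteq> pverts F" "parcs F `` A \<subseteq> A"
  shows "3 dvd card A"
  using assms
proof (induction arbitrary: A)
  case empty
  then show ?case by simp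
next
  case (add_P3 F v x y S)
  note wf = stripe_family_wf[OF add_P3.hyps(1)]
  have old: "3 dvd card (A \<inter> pverts F)"
    using add_P3.prems wf by (intro add_P3.IH) auto
  have "v \<in> A \<longleftrightarrow> x \<in> A" "x \<in> A \<longleftrightarrow> y \<in> A" using add_P3.prems(2) by auto
  then consider "A \<inter> {v, x, y} = {}" | "{v, x, y} \<subseteq> A" by blast
  then show ?case
  proof cases
    case 1
    then have "A \<inter> pverts F = A" using add_P3.prems(1) by auto
    then show ?thesis using old by simp
  next
    case 2
    then have "A = (A \<inter> pverts F) \<union> {v, x, y}" using add_P3.prems(1) by auto
    moreover have "card ((A \<inter> pverts F) \<union> {v, x, y}) = card (A \<inter> pverts F) + card {v, x, y}"
      using add_P3.hyps(3) wf by (intro card_Un_disjoint) auto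
    moreover have "card {v, x, y} = 3" using add_P3.hyps(2) by simp
    ultimately show ?thesis using old by simp
  qed
qed

section \<open>Branches of forests\<close>

definition branch :: "'a pair_pre_digraph \<Rightarrow> 'a \<Rightarrow> 'a \<Rightarrow> 'a set" where
  "branch G v a = (parcs (delete_verts G {v}))\<^sup>* `` {a}"

text \<open>
  Acyclicity in the form in which it is used, and which passes to induced subgraphs at once:
  removing a vertex separates its neighbours from each other.
\<close>

definition undirected_forest :: "'a pair_pre_digraph \<Rightarrow> bool" where
  "undirected_forest G \<longleftrightarrow> pair_graph G \<and>
     (\<forall>v a b. (v, a) \<in> parcs G \<longrightarrow> (v, b) \<in> parcs G \<longrightarrow> a \<noteq> b \<longrightarrow> b \<notin> branch G v a)"

lemma pair_graph_delete_verts: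
  assumes "pair_graph G"
  shows "pair_graph (delete_verts G S)"
proof -
  interpret pair_graph G by fact
  show ?thesis
  proof unfold_locales
    show "finite (parcs (delete_verts G S))"
      by (rule finite_subset[OF _ pair_finite_arcs]) auto
    show "symmetric (with_proj (delete_verts G S))"
      using pair_sym_arcs by (auto simp: symmetric_def sym_def)
  qed (use pair_finite_verts in \<open>auto dest: in_arcsD1 in_arcsD2 no_loops'\<close>)
qed

lemma undirected_forest_delete_verts:
  assumes "undirected_forest G"
  shows "undirected_forest (delete_verts G S)"
proof -
  have "branch (delete_verts G S) v a \<subseteq> branch G v a" for v a
    unfolding branch_def by (intro Image_mono rtrancl_mono) auto
  then show ?thesis
    using assms pair_graph_delete_verts unfolding undirected_forest_def by fastforce
qed

lemma undirected_tree_imp_forest: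
  assumes "undirected_tree T"
  shows "undirected_forest T"
  unfolding undirected_forest_def
proof (intro conjI allI impI notI)
  show pg: "pair_graph T" using assms by (simp add: undirected_tree_def)
  fix v a b assume va: "(v, a) \<in> parcs T" and vb: "(v, b) \<in> parcs T" and "a \<noteq> b"
    and b: "b \<in> branch T v a"
  let ?H = "delete_verts T {v}"
  interpret T: pair_graph T by fact
  interpret H: pair_graph ?H using pair_graph_delete_verts[OF pg] .
  have bv: "(b, v) \<in> parcs T" using vb T.pair_sym_arcs by (auto simp: symmetric_def sym_def)
  have "a \<in> pverts ?H" using va T.in_arcsD2 T.no_loops' by fastforce
  moreover have "(a, b) \<in> (parcs ?H)\<^sup>*" using b by (simp add: branch_def)
  ultimately have "reachable (with_proj ?H) a b"
    by (simp add: H.reachable_conv')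
  then obtain p where p: "H.apath a p b" using H.reachable_apath by blast
  have vs: "set (pawalk_verts a p) \<subseteq> pverts ?H" and dist: "distinct (pawalk_verts a p)"
    using p H.awalkI_apath[OF p] H.awalk_verts_in_verts unfolding H.apath_def by blast+
  have walk: "pcas a p b" "set p \<subseteq> parcs T"
    using p unfolding H.apath_def H.awalk_def by auto
  \<comment> \<open>The path from \<open>a\<close> to \<open>b\<close> closes to a cycle through \<open>v\<close>.\<close>
  have append: "pcas u q w \<Longrightarrow> pcas u (q @ [(w, v)]) v"
    "pcas u q w \<Longrightarrow> pawalk_verts u (q @ [(w, v)]) = pawalk_verts u q @ [v]" for u q w
    by (induction q arbitrary: u) auto
  let ?c = "(v, a) # p @ [(b, v)]"
  have "p \<noteq> []" using walk(1) \<open>a \<noteq> b\<close> by auto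
  then have len: "3 \<le> length ?c" by (cases p) auto
  have "T.awalk v ?c v"
    unfolding T.awalk_def using walk va bv append(1) T.in_arcsD1 by auto
  moreover have "distinct (tl (pawalk_verts v ?c))"
    using append(2)[OF walk(1)] dist vs by auto
  ultimately have "T.cycle ?c" unfolding T.cycle_def by blast
  then show False using assms len unfolding undirected_tree_def by blast
qed

lemma self_in_branch: "a \<in> branch G v a"
  by (simp add: branch_def)

lemma branch_closed:
  assumes "u \<in> branch G v a" "(u, w) \<in> parcs G" "u \<noteq> v" "w \<noteq> v"
  shows "w \<in> branch G v a"
  using assms unfolding branch_def by (auto intro: rtrancl_into_rtrancl)

lemma branch_avoids:
  assumes "a \<noteq> v" shows "v \<notin> branch G v a"
  using assms unfolding branch_def by (auto elim: rtranclE)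

lemma branch_subset_verts:
  assumes "pair_graph G" "a \<in> pverts G" shows "branch G v a \<subseteq> pverts G"
proof
  interpret pair_graph G by fact
  fix w assume "w \<in> branch G v a"
  then have "(a, w) \<in> (parcs (delete_verts G {v}))\<^sup>*" by (simp add: branch_def)
  then show "w \<in> pverts G" using assms(2) by (auto elim: rtranclE dest: in_arcsD2)
qed

text \<open>
  This transports the divisibility to branches: when \<open>v\<close> is among the deleted vertices, what is
  left of a branch at \<open>v\<close> is a union of components.
\<close>

lemma three_dvd_card_branch:
  assumes "pair_graph G" "delete_verts G S \<in> stripe_family" "v \<in> S" "a \<in> pverts G"
  shows "3 dvd card (branch G v a - S)"
proof (rule three_dvd_card_closed[OF assms(2)])
  show "branch G v a - S \<subseteq> pverts (delete_verts G S)"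
    using branch_subset_verts[OF assms(1,4)] by auto
  show "parcs (delete_verts G S) `` (branch G v a - S) \<subseteq> branch G v a - S"
    using assms(3) branch_closed by fastforce
qed

section \<open>Peeling off a forced path\<close>

text \<open>
  A winning first move is a leaf. The branch at a second neighbour \<open>z\<close> cannot consist of \<open>z\<close>
  alone, as its size is divisible by 3; so Minimizer could answer inside this branch.
\<close>

lemma winning_move_only_neighbour:
  assumes "undirected_forest G"
    and resp: "\<And>x y. (x, y) \<in> P3_copies_from G v \<Longrightarrow> delete_verts G {v, x, y} \<in> stripe_family"
    and xy: "(x, y) \<in> P3_copies_from G v" and vz: "(v, z) \<in> parcs G"
  shows "z = x"
proof (rule ccontr)
  assume "z \<noteq> x"
  have pg: "pair_graph G" using assms(1) by (simp add: undirected_forest_def)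
  then interpret pair_graph G .
  note xy' = P3_copies_fromD[OF xy]
  have z: "z \<in> pverts G" "z \<noteq> v" using vz in_arcsD2 no_loops' by blast+
  let ?D = "branch G v z"
  have fin: "finite ?D"
    using branch_subset_verts[OF pg z(1)] pair_finite_verts finite_subset by blast
  have v: "v \<notin> ?D" using branch_avoids z(2) by metis
  have x: "x \<notin> ?D"
    using assms(1) vz xy'(7) \<open>z \<noteq> x\<close> unfolding undirected_forest_def by blast
  have "(y, x) \<in> parcs G" using xy'(8) pair_sym_arcs by (auto simp: symmetric_def sym_def)
  then have y: "y \<notin> ?D" using x branch_closed xy'(4,5) by metis
  have "3 dvd card (?D - {v, x, y})"
    by (rule three_dvd_card_branch[OF pg resp[OF xy] _ z(1)]) simp
  moreover have "?D - {v, x, y} = ?D" using v x y by blast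
  ultimately have D: "3 dvd card ?D" by simp
  obtain w where w: "(z, w) \<in> parcs G" "w \<noteq> v"
  proof -
    have "\<exists>w. (z, w) \<in> parcs G \<and> w \<noteq> v"
    proof (rule ccontr)
      assume "\<not> ?thesis"
      then have "?D = {z}" unfolding branch_def by (auto elim: converse_rtranclE)
      then show False using D by simp
    qed
    then show ?thesis using that by blast
  qed
  have zw: "(z, w) \<in> P3_copies_from G v"
    using w vz z xy'(1) in_arcsD2 no_loops' by (fastforce simp: P3_copies_from_def)
  have "3 dvd card (?D - {v, z, w})"
    by (rule three_dvd_card_branch[OF pg resp[OF zw] _ z(1)]) simp
  moreover have "card ?D = card (?D - {v, z, w}) + 2"
  proof -
    have mem: "{z, w} \<subseteq> ?D" using self_in_branch branch_closed[OF self_in_branch w(1) z(2) w(2)] by simp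
    have "?D - {v, z, w} = ?D - {z, w}" using v by blast
    moreover have "card {z, w} = 2" using w(1) no_loops' by simp
    ultimately show ?thesis
      using card_Diff_subset[of "{z, w}" ?D] card_mono[OF fin mem] mem by simp
  qed
  ultimately show False using D by presburger
qed

text \<open>
  Two different answers through \<open>x\<close> would require the branch at \<open>z\<close> to have a number of vertices
  divisible by 3 both with and without \<open>z\<close>.
\<close>

lemma winning_move_second_vertex_neighbours:
  assumes "undirected_forest G"
    and resp: "\<And>x y. (x, y) \<in> P3_copies_from G v \<Longrightarrow> delete_verts G {v, x, y} \<in> stripe_family"
    and xy: "(x, y) \<in> P3_copies_from G v" and xz: "(x, z) \<in> parcs G"
  shows "z = v \<or> z = y"
proof (rule ccontr)
  assume ne: "\<not> (z = v \<or> z = y)"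
  have pg: "pair_graph G" using assms(1) by (simp add: undirected_forest_def)
  then interpret pair_graph G .
  note xy' = P3_copies_fromD[OF xy]
  have z: "z \<in> pverts G" "z \<noteq> x" using xz in_arcsD2 no_loops' by blast+
  let ?D = "branch G x z"
  have fin: "finite ?D"
    using branch_subset_verts[OF pg z(1)] pair_finite_verts finite_subset by blast
  have x: "x \<notin> ?D" using branch_avoids z(2) by metis
  have "(x, v) \<in> parcs G" using xy'(7) pair_sym_arcs by (auto simp: symmetric_def sym_def)
  then have vy: "v \<notin> ?D" "y \<notin> ?D"
    using assms(1) xz xy'(8) ne unfolding undirected_forest_def by blast+
  have "3 dvd card (?D - {v, x, y})"
    by (rule three_dvd_card_branch[OF pg resp[OF xy] _ z(1)]) simp
  moreover have "?D - {v, x, y} = ?D" using x vy by blast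
  ultimately have D: "3 dvd card ?D" by simp
  have xz': "(x, z) \<in> P3_copies_from G v"
    using xz z xy' ne by (auto simp: P3_copies_from_def)
  have "3 dvd card (?D - {v, x, z})"
    by (rule three_dvd_card_branch[OF pg resp[OF xz'] _ z(1)]) simp
  moreover have "?D - {v, x, z} = ?D - {z}" using x vy by blast
  ultimately have "3 dvd card (?D - {z})" by simp
  moreover have "card ?D = card (?D - {z}) + 1"
    using fin card_Suc_Diff1[OF fin self_in_branch] by simp
  ultimately show False using D by presburger
qed

text \<open>
  The designated end-vertex is \<open>y\<close>, the far end of the path from the winning move \<open>v\<close>. Two
  neighbours of \<open>y\<close> in one component of the rest would be joined by a walk avoiding \<open>y\<close>.
\<close>

lemma stripe_family_attach_P3:
  assumes "undirected_forest G" and xy: "(x, y) \<in> P3_copies_from G v"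
    and v: "\<And>z. (v, z) \<in> parcs G \<Longrightarrow> z = x"
    and x: "\<And>z. (x, z) \<in> parcs G \<Longrightarrow> z = v \<or> z = y"
    and F: "delete_verts G {v, x, y} \<in> stripe_family"
  shows "G \<in> stripe_family"
proof -
  interpret pair_graph G using assms(1) by (simp add: undirected_forest_def)
  note xy' = P3_copies_fromD[OF xy]
  have sym: "(a, b) \<in> parcs G \<Longrightarrow> (b, a) \<in> parcs G" for a b
    using pair_sym_arcs by (auto simp: symmetric_def sym_def)
  let ?F = "delete_verts G {v, x, y}"
  interpret F: pair_graph ?F by (rule pair_graph_delete_verts) (rule pair_graph)
  define S where "S = {s. (y, s) \<in> parcs G} - {x}"
  have yv: "(y, v) \<notin> parcs G" using v sym xy'(6) by blast
  have S: "S \<subseteq> pverts ?F" using yv in_arcsD2 no_loops' unfolding S_def by auto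
  have one: "card (S \<inter> C) \<le> 1" if C: "C \<in> F.sccs_verts" for C
  proof -
    have "s = t" if "s \<in> S \<inter> C" "t \<in> S \<inter> C" for s t
    proof (rule ccontr)
      assume "s \<noteq> t"
      have "reachable (with_proj ?F) s t" using C that F.in_sccs_verts_conv_reachable by blast
      then have "(s, t) \<in> (parcs ?F)\<^sup>*" by (auto dest: reachable_rtranclI)
      then have "(s, t) \<in> (parcs (delete_verts G {y}))\<^sup>*"
        by (rule rtrancl_mono[THEN subsetD, rotated]) auto
      then have "t \<in> branch G y s" by (simp add: branch_def)
      then show False
        using assms(1) \<open>s \<noteq> t\<close> that unfolding undirected_forest_def S_def by blast
    qed
    moreover have "finite (S \<inter> C)" using S F.pair_finite_verts finite_subset by blast
    ultimately show ?thesis by (simp add: card_le_Suc0_iff_eq)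
  qed
  let ?H = "\<lparr>pverts = pverts ?F \<union> {y, x, v}, parcs = parcs ?F \<union>
      {(y, x), (x, y), (x, v), (v, x)} \<union> {y} \<times> S \<union> S \<times> {y}\<rparr>"
  have "?H \<in> stripe_family"
    using F S one xy' by (intro stripe_family.add_P3) auto
  moreover have "?H = G"
  proof (intro pair_pre_digraph.equality)
    show "parcs ?H = parcs G" (is "?L = _")
    proof (intro subset_antisym subrelI)
      fix a b assume "(a, b) \<in> ?L"
      then show "(a, b) \<in> parcs G" using xy' sym by (auto simp: S_def)
    next
      fix a b assume ab: "(a, b) \<in> parcs G"
      then have "a = v \<Longrightarrow> b = x" "b = v \<Longrightarrow> a = x" "a = x \<Longrightarrow> b = v \<or> b = y"
        "b = x \<Longrightarrow> a = v \<or> a = y" using v x sym by blast+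
      then show "(a, b) \<in> ?L" using ab sym[OF ab] by (auto simp: S_def)
    qed
  qed (use xy' in auto)
  ultimately show ?thesis by simp
qed

lemma perfect_forest_in_stripe_family:
  assumes "undirected_forest G" "stripe_perfect Maximizer G"
  shows "G \<in> stripe_family"
  using assms
proof (induction "card (pverts G)" arbitrary: G rule: less_induct)
  case less
  interpret pair_graph G using less.prems(1) by (simp add: undirected_forest_def)
  show ?case
  proof (cases "pverts G = {}")
    case True
    then have "G = \<lparr>pverts = {}, parcs = {}\<rparr>"
      using in_arcsD1 by (intro pair_pre_digraph.equality) auto
    then show ?thesis using stripe_family.empty by simp
  next
    case False
    then obtain v where v: "v \<in> initiator_moves G" and win: "\<And>x y. (x, y) \<in> P3_copies_from G v \<Longrightarrow>
        stripe_perfect Maximizer (delete_verts G {v, x, y})"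
      using less.prems(2) stripe_perfect_Maximizer_iff_move[OF pair_finite_verts] by blast
    have resp: "delete_verts G {v, x, y} \<in> stripe_family" if "(x, y) \<in> P3_copies_from G v" for x y
      using win[OF that] card_delete_P3[OF that pair_finite_verts]
        undirected_forest_delete_verts[OF less.prems(1)]
      by (intro less.hyps) simp_all
    obtain x y where xy: "(x, y) \<in> P3_copies_from G v"
      using v by (auto simp: initiator_moves_def)
    show ?thesis
      using stripe_family_attach_P3[OF less.prems(1) xy _ _ resp[OF xy]]
        winning_move_only_neighbour[OF less.prems(1) resp xy]
        winning_move_second_vertex_neighbours[OF less.prems(1) resp xy] by blast
  qed
qed

theorem lemma11:
  fixes T :: "'a pair_pre_digraph"
  assumes "undirected_tree T"
  shows "stripe_perfect Maximizer T \<longleftrightarrow> T \<in> stripe_family"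
  using perfect_forest_in_stripe_family[OF undirected_tree_imp_forest[OF assms]]
    stripe_family_perfect by blast

end
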